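(* For all coprime integers $p>q>1$ there is a sofic subshift $Z_{p/q}$ (over some finite alphabet) such that $P_{Z_{p/q}}(n)=P_{\Xi_{p/q}}(n)$ for every integer $n\ge 0$.
   Context: For $n\ge 2$ let $\Sigma_n=\{0,1,\dots,n-1\}$. For a finite alphabet $A$, $A^{\mathbb{Z}}$ carries the product topology, and $\sigma(x)[i]=x[i+1]$ is the shift map. A subshift is a nonempty closed $X\subseteq A^{\mathbb{Z}}$ with $\sigma(X)=X$. Its language $L(X)\subseteq A^*$ is the set of all finite words occurring as subwords of elements of $X$ (including the empty word), and its complexity function is $P_X(n)=|L(X)\cap A^n|$, $n\ge 0$. A subshift $X$ is sofic if $L(X)$ is a regular language. For coprime integers $s,t>1$, write $a,b\in\Sigma_{st}$ uniquely as $a=a_1t+a_0$, $b=b_1t+b_0$ with $a_0,b_0\in\Sigma_t$, $a_1,b_1\in\Sigma_s$, and put $g_{s,st}(a,b)=a_0s+b_1$. Let $f_{s/t,st}(a,c,b)=g_{s,st}(g_{s,st}(a,c),g_{s,st}(c,b))$. The multiplication automaton $\Pi_{s/t,st}:\Sigma_{st}^{\mathbb{Z}}\to\Sigma_{st}^{\mathbb{Z}}$ is $\Pi_{s/t,st}(x)[i]=f_{s/t,st}(x[i-1],x[i],x[i+1])$; it is a bijection with inverse $\Pi_{t/s,st}$ and it multiplies by $s/t$ in base $st$. The trace of $x\in\Sigma_{st}^{\mathbb{Z}}$ is $\mathrm{Tr}_{s/t}(x)\in\Sigma_{st}^{\mathbb{Z}}$, $\mathrm{Tr}_{s/t}(x)[k]=\Pi_{s/t,st}^k(x)[0]$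 for $k\in\mathbb{Z}$, and the trace subshift is $\Xi_{s/t}=\mathrm{Tr}_{s/t}(\Sigma_{st}^{\mathbb{Z}})$. *)

theory Defs
  imports "HOL-Analysis.Analysis"
begin

section \<open>Subshifts, languages and complexity\<close>

definition full_shift :: "'a set \<Rightarrow> (int \<Rightarrow> 'a) set" where
  "full_shift A = {x. \<forall>i. x i \<in> A}"

definition full_shift_topology :: "'a set \<Rightarrow> (int \<Rightarrow> 'a) topology" where
  "full_shift_topology A = product_topology (\<lambda>_. discrete_topology A) UNIV"

lemma topspace_full_shift_topology: "topspace (full_shift_topology A) = full_shift A"
  by (auto simp: full_shift_topology_def full_shift_def PiE_UNIV_domain)

definition shift_map :: "(int \<Rightarrow> 'a) \<Rightarrow> int \<Rightarrow> 'a" where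
  "shift_map x = (\<lambda>i. x (i + 1))"

definition subshift :: "'a set \<Rightarrow> (int \<Rightarrow> 'a) set \<Rightarrow> bool" where
  "subshift A X \<longleftrightarrow>
     finite A \<and> X \<noteq> {} \<and> closedin (full_shift_topology A) X \<and> shift_map ` X = X"

definition language :: "(int \<Rightarrow> 'a) set \<Rightarrow> 'a list set" where
  "language X = {map (\<lambda>j. x (i + int j)) [0..<n] | x i n. x \<in> X}"

text \<open>For \<open>X \<subseteq> A\<^sup>\<int>\<close> every word of the language is a word over \<open>A\<close>, so the
  intersection with \<open>A\<^sup>n\<close> only restricts the length.\<close>

definition complexity :: "(int \<Rightarrow> 'a) set \<Rightarrow> nat \<Rightarrow> nat" where
  "complexity X n = card {w \<in> language X. length w = n}"

text \<open>Regularity over the alphabet \<open>A\<close>: acceptance by a deterministic finite automaton with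
  state set \<open>Q\<close>, transition function \<open>\<delta>\<close>, initial state \<open>q\<^sub>0\<close> and final states \<open>F\<close>.
  Taking the states to be natural numbers is no restriction, as \<open>Q\<close> is finite.\<close>

definition regular_language :: "'a set \<Rightarrow> 'a list set \<Rightarrow> bool" where
  "regular_language A L \<longleftrightarrow>
     (\<exists>(Q :: nat set) (\<delta> :: nat \<Rightarrow> 'a \<Rightarrow> nat) q\<^sub>0 F.
        finite Q \<and> q\<^sub>0 \<in> Q \<and> F \<subseteq> Q \<and> (\<forall>q\<in>Q. \<forall>a\<in>A. \<delta> q a \<in> Q) \<and>
        L = {w \<in> lists A. foldl \<delta> q\<^sub>0 w \<in> F})"

definition sofic :: "'a set \<Rightarrow> (int \<Rightarrow> 'a) set \<Rightarrow> bool" where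
  "sofic A X \<longleftrightarrow> subshift A X \<and> regular_language A (language X)"

section \<open>Multiplication automata and trace subshifts\<close>

text \<open>With \<open>a = a\<^sub>1 t + a\<^sub>0\<close> and \<open>b = b\<^sub>1 t + b\<^sub>0\<close> this is \<open>a\<^sub>0 s + b\<^sub>1\<close>, for
  \<open>a, b < s t\<close>.\<close>

definition g_rule :: "nat \<Rightarrow> nat \<Rightarrow> nat \<Rightarrow> nat \<Rightarrow> nat" where
  "g_rule s t a b = (a mod t) * s + b div t"

definition f_rule :: "nat \<Rightarrow> nat \<Rightarrow> nat \<Rightarrow> nat \<Rightarrow> nat \<Rightarrow> nat" where
  "f_rule s t a c b = g_rule s t (g_rule s t a c) (g_rule s t c b)"

definition mult_automaton :: "nat \<Rightarrow> nat \<Rightarrow> (int \<Rightarrow> nat) \<Rightarrow> int \<Rightarrow> nat" where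
  "mult_automaton s t x = (\<lambda>i. f_rule s t (x (i - 1)) (x i) (x (i + 1)))"

text \<open>Integer powers of a bijection \<open>F\<close> of \<open>S\<close>; the inverse is taken on \<open>S\<close> only.\<close>

definition int_iterate :: "'b set \<Rightarrow> ('b \<Rightarrow> 'b) \<Rightarrow> int \<Rightarrow> 'b \<Rightarrow> 'b" where
  "int_iterate S F k =
     (if 0 \<le> k then F ^^ nat k else inv_into S F ^^ nat (- k))"

definition trace_map :: "nat \<Rightarrow> nat \<Rightarrow> (int \<Rightarrow> nat) \<Rightarrow> int \<Rightarrow> nat" where
  "trace_map s t x = (\<lambda>k. int_iterate (full_shift {..<s * t}) (mult_automaton s t) k x 0)"

definition trace_subshift :: "nat \<Rightarrow> nat \<Rightarrow> (int \<Rightarrow> nat) set" where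
  "trace_subshift s t = trace_map s t ` full_shift {..<s * t}"

end

theory Submission
  imports Defs "HOL-Number_Theory.Cong"
begin

text \<open>For a real number \<open>\<xi>\<close> let \<open>x\<close> be the configuration of its base \<open>p q\<close> digits, the integer part
  being taken modulo powers of \<open>p q\<close>. The automaton multiplies \<open>\<xi>\<close> by \<open>p / q\<close>, and such
  configurations are dense, so the words of length \<open>n\<close> of the trace subshift are the sequences of
  residues modulo \<open>p q\<close> of the floors of \<open>\<xi> (p / q)\<^sup>k\<close>, \<open>k < n\<close>. With \<open>\<xi> = N / p\<^sup>n\<^sup>-\<^sup>1\<close>
  these floors are \<open>N div d\<^sub>k\<close>, where \<open>d\<^sub>k = q\<^sup>k p\<^sup>n\<^sup>-\<^sup>1\<^sup>-\<^sup>k\<close>, and only \<open>N\<close> modulo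
  \<open>p\<^sup>n q\<^sup>n\<close> matters. The residues determine the floors, hence the number of words is the number of
  points \<open>N < p\<^sup>n q\<^sup>n\<close> at which some floor jumps, i.e. which are divisible by some \<open>d\<^sub>k\<close>. This
  number satisfies \<open>c\<^sub>n\<^sub>+\<^sub>1 = p c\<^sub>n + (q - 1) p q\<^sup>n\<close>, a recursion that is realised by a
  sofic shift whose sequences of differences modulo \<open>p q\<close> form the language \<open>Q\<^sup>* P\<^sup>*\<close>.\<close>

section \<open>Trace words as residues of floors\<close>

text \<open>As \<open>F\<close> maps \<open>S\<close> onto \<open>S\<close>,
  \<open>inv_into S F\<close> is a right inverse on \<open>S\<close>, so a step forward cancels a
  step back. This turns any window of a trace into a forward orbit.\<close>

lemma int_iterate_add:
  assumes "F ` S = S" "x \<in> S"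
  shows "int_iterate S F i x \<in> S"
    and "int_iterate S F (i + int j) x = (F ^^ j) (int_iterate S F i x)"
proof -
  have inv: "(inv_into S F ^^ m) x \<in> S" for m
    using assms by (induction m) (simp_all add: inv_into_into)
  have fwd: "(F ^^ m) x \<in> S" for m
    using assms by (induction m) auto
  show "int_iterate S F i x \<in> S"
    using inv fwd by (simp add: int_iterate_def)
  have step: "int_iterate S F (i + 1) x = F (int_iterate S F i x)" for i
  proof (cases "0 \<le> i")
    case True
    then have "nat (i + 1) = Suc (nat i)" by simp
    with True show ?thesis by (simp add: int_iterate_def)
  next
    case False
    define m where "m = nat (- i) - 1"
    have m: "nat (- i) = Suc m" "nat (- (i + 1)) = m" using False by (auto simp: m_def)
    have "F (inv_into S F ((inv_into S F ^^ m) x)) = (inv_into S F ^^ m) x"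
      using inv[of m] assms(1) by (simp add: f_inv_into_f)
    then have *: "F (int_iterate S F i x) = (inv_into S F ^^ m) x"
      using False m by (simp add: int_iterate_def)
    show ?thesis
    proof (cases "i = -1")
      case True
      then show ?thesis using * m by (simp add: int_iterate_def)
    next
      case False
      then show ?thesis using * m \<open>\<not> 0 \<le> i\<close> by (simp add: int_iterate_def)
    qed
  qed
  show "int_iterate S F (i + int j) x = (F ^^ j) (int_iterate S F i x)"
  proof (induction j)
    case (Suc j)
    have "int_iterate S F (i + int (Suc j)) x = int_iterate S F (i + int j + 1) x"
      by (simp add: ac_simps)
    also have "\<dots> = (F ^^ Suc j) (int_iterate S F i x)"
      unfolding step Suc by simp
    finally show ?case .
  qed simp
qed

text \<open>Fixing finitely many coordinates gives a basic open set of the product topology, so the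
  hypothesis makes the complement of \<open>X\<close> open.\<close>

lemma closedin_full_shift:
  assumes "X \<subseteq> full_shift A"
    and cyl: "\<And>y. y \<in> full_shift A \<Longrightarrow> y \<notin> X \<Longrightarrow>
      \<exists>I. finite I \<and> (\<forall>z \<in> full_shift A. (\<forall>i\<in>I. z i = y i) \<longrightarrow> z \<notin> X)"
  shows "closedin (full_shift_topology A) X"
proof -
  have "openin (full_shift_topology A) (full_shift A - X)"
  proof (subst openin_subopen, intro ballI)
    fix y assume y: "y \<in> full_shift A - X"
    from y have "y \<in> full_shift A" "y \<notin> X" by simp_all
    from cyl[OF this] obtain I
      where I: "finite I" "\<forall>z \<in> full_shift A. (\<forall>i\<in>I. z i = y i) \<longrightarrow> z \<notin> X"
      by (elim exE conjE)
    define C where "C = (\<Pi>\<^sub>E i\<in>UNIV. if i \<in> I then {y i} else A)"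
    have yA: "y i \<in> A" for i using y by (simp add: full_shift_def)
    have "{i. (if i \<in> I then {y i} else A) \<noteq> topspace (discrete_topology A)} \<subseteq> I" by auto
    then have "openin (full_shift_topology A) C"
      unfolding C_def full_shift_topology_def using I(1) yA
      by (intro product_topology_basis) (auto intro: finite_subset)
    moreover have "y \<in> C" using yA by (auto simp: C_def PiE_UNIV_domain)
    moreover have "C \<subseteq> full_shift A - X"
    proof
      fix z assume "z \<in> C"
      then have z: "z i \<in> (if i \<in> I then {y i} else A)" for i
        unfolding C_def by (rule PiE_mem) simp
      then have "z i \<in> A" "i \<in> I \<Longrightarrow> z i = y i" for i
        using z[of i] yA[of i] by (cases "i \<in> I"; simp)+
      then show "z \<in> full_shift A - X" using I(2) by (simp add: full_shift_def)
    qed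
    ultimately show "\<exists>C. openin (full_shift_topology A) C \<and> y \<in> C \<and> C \<subseteq> full_shift A - X"
      by blast
  qed
  then show ?thesis using assms(1) by (simp add: closedin_def topspace_full_shift_topology)
qed

lemma nat_with_digits:
  fixes y :: "nat \<Rightarrow> nat"
  assumes "\<And>j. y j < b"
  shows "\<exists>N. \<forall>j<m. (N div b ^ j) mod b = y j"
  using assms
proof (induction m arbitrary: y)
  case (Suc m)
  obtain N where N: "\<forall>j<m. (N div b ^ j) mod b = y (Suc j)"
    using Suc.IH[of "\<lambda>j. y (Suc j)"] Suc.prems by auto
  have y0: "y 0 < b" using Suc.prems by simp
  have "((y 0 + b * N) div b ^ j) mod b = y j" if "j < Suc m" for j
  proof (cases j)
    case (Suc i)
    have "(y 0 + b * N) div b ^ j = ((y 0 + b * N) div b) div b ^ i"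
      by (simp add: Suc div_mult2_eq)
    then show ?thesis using N that Suc y0 by simp
  qed (use y0 in simp)
  then show ?case by blast
qed simp

text \<open>Position 0 is the units digit and positive \<open>i\<close> lie behind the point. Since
  \<open>mod\<close> on integers is nonnegative, negative \<open>\<xi>\<close> get complement
  digits.\<close>

definition digit :: "nat \<Rightarrow> real \<Rightarrow> int \<Rightarrow> nat" where
  "digit b \<xi> i = nat (\<lfloor>\<xi> * real b powi i\<rfloor> mod int b)"

lemma language_wordI: "x \<in> X \<Longrightarrow> map (\<lambda>j. x (i + int j)) [0..<n] \<in> language X"
  unfolding language_def by blast

lemma g_rule_less: "a < s * t \<Longrightarrow> c < s * t \<Longrightarrow> g_rule s t a c < s * t"
proof -
  assume "a < s * t" "c < s * t"
  then have "t > 0" "c div t < s" by (auto intro!: Nat.gr0I simp: less_mult_imp_div_less)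
  moreover from this have "a mod t + 1 \<le> t" by (simp add: Suc_leI)
  then have "(a mod t + 1) * s \<le> t * s" by (rule mult_le_mono1)
  ultimately show ?thesis unfolding g_rule_def by (simp add: algebra_simps)
qed

text \<open>The two inner values carry \<open>b div s\<close> and \<open>b mod s\<close>, and the
  outer rule reassembles \<open>b\<close> from them.\<close>

lemma g_rule_inverse:
  assumes "b < s * t" "s > 0" "t > 0" "a < s * t" "c < s * t"
  shows "g_rule s t (g_rule t s a b) (g_rule t s b c) = b"
proof -
  have "b div s < t" "c div s < t" using assms by (simp_all add: less_mult_imp_div_less mult.commute)
  then show ?thesis unfolding g_rule_def using assms by simp
qed

section \<open>The automaton as multiplication by \<open>p / q\<close> on digit sequences\<close>

locale coprime_pair =
  fixes p q :: nat
  assumes coprime: "coprime p q" and p_gt_1: "p > 1" and q_gt_1: "q > 1"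
begin

abbreviation "S \<equiv> full_shift {..<p * q}"
abbreviation "F \<equiv> mult_automaton p q"

definition half_step :: "(int \<Rightarrow> nat) \<Rightarrow> int \<Rightarrow> nat" where
  "half_step x = (\<lambda>i. g_rule p q (x i) (x (i + 1)))"

text \<open>A half step multiplies by \<open>p\<close>. Two of them followed by a shift by one
  place, a division by \<open>p * q\<close>, multiply by \<open>p / q\<close>.\<close>

lemma mult_automaton_half_step: "F x i = half_step (half_step x) (i - 1)"
  by (simp add: mult_automaton_def f_rule_def half_step_def add.commute[of 1])

lemma half_step_image: "half_step ` S = S"
proof
  show "half_step ` S \<subseteq> S" by (auto simp: full_shift_def half_step_def intro: g_rule_less)
  show "S \<subseteq> half_step ` S"
  proof
    fix y assume y: "y \<in> S"
    define x where "x = (\<lambda>i. g_rule q p (y (i - 1)) (y i))"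
    have "x \<in> S" using y g_rule_less[of _ q p] by (auto simp: x_def full_shift_def mult.commute)
    moreover have "half_step x = y"
    proof
      fix i
      show "half_step x i = y i"
        using g_rule_inverse[of "y i" p q "y (i - 1)" "y (i + 1)"] y p_gt_1 q_gt_1
        by (simp add: half_step_def x_def full_shift_def)
    qed
    ultimately show "y \<in> half_step ` S" by blast
  qed
qed

lemma mult_automaton_image: "F ` S = S"
proof
  have "half_step (half_step x) \<in> S" if "x \<in> S" for x using that half_step_image by blast
  then show "F ` S \<subseteq> S" by (auto simp: mult_automaton_half_step full_shift_def)
  show "S \<subseteq> F ` S"
  proof
    fix y assume "y \<in> S"
    then have "(\<lambda>i. y (i + 1)) \<in> half_step ` half_step ` S"
      unfolding half_step_image by (simp add: full_shift_def)
    then obtain x where x: "(\<lambda>i. y (i + 1)) = half_step (half_step x)" and "x \<in> S"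
      unfolding image_image by (rule imageE)
    have "F x = y" by (rule ext) (simp add: mult_automaton_half_step flip: x)
    with \<open>x \<in> S\<close> show "y \<in> F ` S" by blast
  qed
qed

text \<open>A window starting at \<open>i\<close> is the window starting at 0 of the configuration
  \<open>int_iterate S F i x\<close>, so forward orbits suffice.\<close>

lemma language_trace_subshift:
  "{w \<in> language (trace_subshift p q). length w = n} =
     (\<lambda>x. map (\<lambda>k. (F ^^ k) x 0) [0..<n]) ` S"
proof -
  have shift: "map (\<lambda>j. trace_map p q x (i + int j)) [0..<n] =
      map (\<lambda>k. (F ^^ k) (int_iterate S F i x) 0) [0..<n]" if "x \<in> S" for x i
    using int_iterate_add(2)[OF mult_automaton_image that] by (simp add: trace_map_def)
  have zero: "int_iterate S F 0 x = x" for x by (simp add: int_iterate_def)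
  show ?thesis
  proof (intro equalityI subsetI)
    fix w assume "w \<in> {w \<in> language (trace_subshift p q). length w = n}"
    then have "w \<in> language (trace_subshift p q)" and n: "length w = n" by auto
    then obtain y i m where y: "y \<in> trace_subshift p q" and w: "w = map (\<lambda>j. y (i + int j)) [0..<m]"
      unfolding language_def by blast
    from w n have "m = n" by simp
    moreover from y obtain x where "x \<in> S" "y = trace_map p q x"
      unfolding trace_subshift_def by blast
    ultimately have "x \<in> S" "w = map (\<lambda>j. trace_map p q x (i + int j)) [0..<n]"
      using w by simp_all
    then show "w \<in> (\<lambda>x. map (\<lambda>k. (F ^^ k) x 0) [0..<n]) ` S"
      using shift int_iterate_add(1)[OF mult_automaton_image] by auto
  next
    fix w assume "w \<in> (\<lambda>x. map (\<lambda>k. (F ^^ k) x 0) [0..<n]) ` S"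
    then obtain x where "x \<in> S" "w = map (\<lambda>j. trace_map p q x (0 + int j)) [0..<n]"
      using shift[of _ 0] zero by auto
    moreover from this have "trace_map p q x \<in> trace_subshift p q"
      by (simp add: trace_subshift_def)
    ultimately show "w \<in> {w \<in> language (trace_subshift p q). length w = n}"
      using language_wordI[of _ "trace_subshift p q" 0 n] by simp
  qed
qed

abbreviation "dig \<equiv> digit (p * q)"

text \<open>All three digits involved are functions of one integer \<open>m\<close>, the expansion
  read one place further. The claim becomes the mixed radix splitting of \<open>m div q\<close>
  modulo \<open>p * q\<close> into its residue modulo \<open>p\<close> and a quotient modulo
  \<open>q\<close>.\<close>

lemma half_step_dig: "half_step (dig \<xi>) = dig (real p * \<xi>)"
proof
  fix i
  define w where "w = \<xi> * real (p * q) powi i"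
  define m where "m = \<lfloor>w * real (p * q)\<rfloor>"
  have pos: "real p > 0" "real q > 0" "p > 0" "q > 0" using p_gt_1 q_gt_1 by auto
  have w: "\<lfloor>w\<rfloor> = m div int (p * q)"
    using floor_divide_real_eq_div[of "int (p * q)" "w * real (p * q)"] pos by (simp add: m_def)
  have pw: "\<lfloor>real p * w\<rfloor> = m div int q"
    using floor_divide_real_eq_div[of "int q" "w * real (p * q)"] pos
    by (simp add: m_def mult.commute)
  have d0: "dig \<xi> i = nat ((m div int (p * q)) mod int (p * q))"
    unfolding digit_def w_def[symmetric] w ..
  have "\<xi> * real (p * q) powi (i + 1) = w * real (p * q)"
    using pos by (simp add: w_def power_int_add)
  then have d1: "dig \<xi> (i + 1) = nat (m mod int (p * q))"
    unfolding digit_def m_def by simp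
  have e: "real p * \<xi> * real (p * q) powi i = real p * w" unfolding w_def by (rule mult.assoc)
  have d2: "dig (real p * \<xi>) i = nat ((m div int q) mod int (p * q))"
    unfolding digit_def e pw ..
  have "((m div int (p * q)) mod int (p * q)) mod int q = m div int (p * q) mod int q"
    by (simp add: mod_mod_cancel)
  moreover have pq: "int (p * q) = int q * int p" by (simp only: of_nat_mult mult.commute)
  then have "m div int (p * q) = m div int q div int p"
    by (simp only: zdiv_zmult2_eq of_nat_0_le_iff)
  moreover have "m mod int (p * q) div int q = m div int q mod int p"
    using zmod_zmult2_eq[of "int p" m "int q"] pos unfolding pq by simp
  moreover have "m div int q mod int (p * q) =
      int p * (m div int q div int p mod int q) + m div int q mod int p"
    using zmod_zmult2_eq[of "int q" "m div int q" "int p"] by simp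
  moreover have "int (nat a mod q * p + nat b div q) = int p * (a mod int q) + b div int q"
    if "0 \<le> a" "0 \<le> b" for a b
    using that by (simp add: zmod_int zdiv_int)
  moreover have "0 \<le> a mod int (p * q)" for a
    using pos by (intro pos_mod_sign) simp
  ultimately have "int (g_rule p q (dig \<xi> i) (dig \<xi> (i + 1))) = m div int q mod int (p * q)"
    unfolding g_rule_def d0 d1 by simp
  then show "half_step (dig \<xi>) i = dig (real p * \<xi>) i"
    unfolding half_step_def d2 by simp
qed

lemma mult_automaton_dig: "(F ^^ k) (dig \<xi>) = dig (\<xi> * (p / q) ^ k)"
proof (induction k)
  case (Suc k)
  have "F (dig \<xi>) = dig (\<xi> * (p / q))" for \<xi>
  proof
    fix i
    have "real p * (real p * \<xi>) * real (p * q) powi (i - 1) = \<xi> * (p / q) * real (p * q) powi i"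
      using p_gt_1 q_gt_1 by (simp add: power_int_diff field_simps)
    then show "F (dig \<xi>) i = dig (\<xi> * (p / q)) i"
      unfolding mult_automaton_half_step half_step_dig by (simp only: digit_def)
  qed
  then show ?case using Suc by (simp add: mult_ac)
qed simp

lemma mult_automaton_local:
  assumes "\<And>j. i - int k \<le> j \<Longrightarrow> j \<le> i + int k \<Longrightarrow> x j = y j"
  shows "(F ^^ k) x i = (F ^^ k) y i"
  using assms
proof (induction k arbitrary: i)
  case (Suc k)
  have "(F ^^ k) x j = (F ^^ k) y j" if "j \<in> {i - 1, i, i + 1}" for j
    using that by (intro Suc.IH Suc.prems) auto
  then show ?case by (simp add: mult_automaton_def[of p q "(F ^^ k) _"])
qed simp

lemma dig_in_S: "dig \<xi> \<in> S"
  using p_gt_1 q_gt_1 by (auto simp: full_shift_def digit_def nat_less_iff)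

lemma dig_dense:
  assumes "x \<in> S"
  shows "\<exists>\<xi>. \<forall>i. - int n \<le> i \<and> i \<le> int n \<longrightarrow> dig \<xi> i = x i"
proof -
  \<comment> \<open>The last position \<open>n\<close> of the window holds the lowest digit of
    \<open>N\<close>, hence the reversed index.\<close>
  obtain N where N: "\<forall>j<2 * n + 1. (N div (p * q) ^ j) mod (p * q) = x (int n - int j)"
    using nat_with_digits[of "\<lambda>j. x (int n - int j)" "p * q" "2 * n + 1"] assms
    unfolding full_shift_def by blast
  have "dig (N / real (p * q) ^ n) i = x i" if "- int n \<le> i \<and> i \<le> int n" for i
  proof -
    define j where "j = nat (int n - i)"
    have i: "i = int n - int j" and j: "j < 2 * n + 1" using that by (auto simp: j_def)
    have "real (p * q) \<noteq> 0" using p_gt_1 q_gt_1 by simp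
    then have "N / real (p * q) ^ n * real (p * q) powi i = real N / real ((p * q) ^ j)"
      unfolding i by (simp add: power_int_diff del: of_nat_mult)
    then have "dig (N / real (p * q) ^ n) i = (N div (p * q) ^ j) mod (p * q)"
      unfolding digit_def by (simp only: floor_divide_of_nat_eq nat_int flip: zmod_int)
    then show ?thesis using N j i by simp
  qed
  then show ?thesis by blast
qed

section \<open>Floors along an orbit\<close>

definition divisor :: "nat \<Rightarrow> nat \<Rightarrow> nat" where
  "divisor n k = q ^ k * p ^ (n - 1 - k)"

lemma divisor_pos: "divisor n k > 0"
  using p_gt_1 q_gt_1 by (simp add: divisor_def)

text \<open>This makes \<open>p ^ n * q ^ n\<close> a period: changing \<open>N\<close> by it
  affects neither the residues of the floors modulo \<open>p * q\<close> nor divisibility by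
  \<open>divisor n k\<close>.\<close>

lemma divisor_dvd: "k < n \<Longrightarrow> divisor n k * (p * q) dvd p ^ n * q ^ n"
proof -
  assume "k < n"
  then have n: "Suc (n - 1 - k) \<le> n" "Suc k \<le> n" by auto
  have "divisor n k * (p * q) = p ^ Suc (n - 1 - k) * q ^ Suc k"
    by (simp add: divisor_def mult_ac)
  moreover have "p ^ Suc (n - 1 - k) dvd p ^ n" "q ^ Suc k dvd q ^ n"
    using n by (simp_all only: le_imp_power_dvd)
  ultimately show ?thesis by (metis mult_dvd_mono)
qed

definition floors :: "nat \<Rightarrow> nat \<Rightarrow> nat list" where
  "floors n N = map (\<lambda>k. N div divisor n k) [0..<n]"

lemma floor_trace:
  assumes "k < n"
  shows "dig (\<xi> * (p / q) ^ k) 0 =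
    nat (\<lfloor>\<xi> * real p ^ (n - 1)\<rfloor> mod int (p ^ n * q ^ n)) div divisor n k mod (p * q)"
proof -
  define M where "M = \<lfloor>\<xi> * real p ^ (n - 1)\<rfloor>"
  define d where "d = divisor n k"
  obtain c where c: "p ^ n * q ^ n = d * (p * q) * c"
    using divisor_dvd[OF assms] unfolding d_def dvd_def by blast
  have dpos: "d > 0" using divisor_pos by (simp add: d_def)
  have "real p ^ (n - 1) = real p ^ k * real p ^ (n - 1 - k)"
    using assms by (simp flip: power_add)
  then have "\<xi> * (p / q) ^ k = \<xi> * real p ^ (n - 1) / real_of_int (int d)"
    using p_gt_1 q_gt_1 by (simp add: d_def divisor_def power_divide)
  then have "\<lfloor>\<xi> * (p / q) ^ k\<rfloor> = M div int d"
    using floor_divide_real_eq_div[of "int d" "\<xi> * real p ^ (n - 1)"] by (simp add: M_def)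
  then have "dig (\<xi> * (p / q) ^ k) 0 = nat (M div int d mod int (p * q))"
    by (simp add: digit_def)
  \<comment> \<open>The modulus is \<open>d\<close> times a multiple of \<open>p * q\<close>, so
    reducing \<open>M\<close> first does not change the quotient modulo
    \<open>p * q\<close>.\<close>
  moreover have "M mod int (p ^ n * q ^ n) div int d = M div int d mod int (p * q * c)"
    using zmod_zmult2_eq[of "int (p * q * c)" M "int d"] dpos by (simp add: c mult.assoc)
  then have "M mod int (p ^ n * q ^ n) div int d mod int (p * q) = M div int d mod int (p * q)"
    by (simp add: mod_mod_cancel)
  moreover have "0 \<le> M mod int (p ^ n * q ^ n)"
    using p_gt_1 q_gt_1 by (intro pos_mod_sign) (simp del: of_nat_power)
  ultimately show ?thesis
    unfolding M_def[symmetric] d_def[symmetric]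
    by (metis nat_div_distrib nat_int nat_mod_distrib of_nat_0_le_iff pos_imp_zdiv_nonneg_iff dpos of_nat_0_less_iff)
qed

text \<open>For one inclusion, \<open>n\<close> steps at position 0 see only positions from
  \<open>-n\<close> to \<open>n\<close>, where \<open>x\<close> agrees with the digits of some real
  \<open>\<xi>\<close>. For the other, \<open>\<xi> = N / p ^ (n - 1)\<close> realises a given
  \<open>N\<close>.\<close>

lemma trace_words:
  "(\<lambda>x. map (\<lambda>k. (F ^^ k) x 0) [0..<n]) ` S =
     (\<lambda>N. map (\<lambda>m. m mod (p * q)) (floors n N)) ` {..<p ^ n * q ^ n}"
proof (intro equalityI image_subsetI)
  have pos: "int (p ^ n * q ^ n) > 0" using p_gt_1 q_gt_1 by (simp del: of_nat_power)
  fix x assume "x \<in> S"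
  then obtain \<xi> where \<xi>: "\<And>i. - int n \<le> i \<Longrightarrow> i \<le> int n \<Longrightarrow> dig \<xi> i = x i"
    using dig_dense by blast
  define N where "N = nat (\<lfloor>\<xi> * real p ^ (n - 1)\<rfloor> mod int (p ^ n * q ^ n))"
  have "(F ^^ k) x 0 = N div divisor n k mod (p * q)" if "k < n" for k
  proof -
    have "(F ^^ k) x 0 = (F ^^ k) (dig \<xi>) 0"
      using that by (intro mult_automaton_local) (simp add: \<xi>)
    then show ?thesis unfolding mult_automaton_dig floor_trace[OF that] N_def .
  qed
  then have "map (\<lambda>k. (F ^^ k) x 0) [0..<n] = map (\<lambda>m. m mod (p * q)) (floors n N)"
    by (simp add: floors_def)
  moreover have "N < p ^ n * q ^ n"
    unfolding N_def using pos pos_mod_bound[OF pos] by (simp add: nat_less_iff del: of_nat_mult of_nat_power)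
  ultimately show "map (\<lambda>k. (F ^^ k) x 0) [0..<n] \<in>
      (\<lambda>N. map (\<lambda>m. m mod (p * q)) (floors n N)) ` {..<p ^ n * q ^ n}" by blast
next
  fix N assume N: "N \<in> {..<p ^ n * q ^ n}"
  define \<xi> where "\<xi> = N / real p ^ (n - 1)"
  have "\<lfloor>\<xi> * real p ^ (n - 1)\<rfloor> = int N" using p_gt_1 by (simp add: \<xi>_def)
  then have "nat (\<lfloor>\<xi> * real p ^ (n - 1)\<rfloor> mod int (p ^ n * q ^ n)) = N"
    using N by (simp del: of_nat_mult of_nat_power flip: zmod_int)
  then have "map (\<lambda>m. m mod (p * q)) (floors n N) = map (\<lambda>k. (F ^^ k) (dig \<xi>) 0) [0..<n]"
    unfolding mult_automaton_dig floors_def using floor_trace[of _ n \<xi>] by simp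
  then show "map (\<lambda>m. m mod (p * q)) (floors n N) \<in> (\<lambda>x. map (\<lambda>k. (F ^^ k) x 0) [0..<n]) ` S"
    using dig_in_S by auto
qed

section \<open>Counting trace words\<close>

text \<open>Both sides divide \<open>N\<close> by the same number
  \<open>divisor n (Suc k) * p = divisor n k * q\<close>.\<close>

lemma divisor_Suc: "Suc k < n \<Longrightarrow> N div divisor n (Suc k) div p = N div divisor n k div q"
proof -
  assume "Suc k < n"
  then have "n - 1 - k = Suc (n - 1 - Suc k)" by simp
  then have "divisor n (Suc k) * p = divisor n k * q" by (simp add: divisor_def)
  then show ?thesis by (metis div_mult2_eq)
qed

text \<open>The floors \<open>m k\<close> satisfy \<open>m (k + 1) div p = m k div q\<close>. Read from right to left, this lifts
  the residues modulo \<open>p q\<close> to a residue of \<open>m 0\<close> modulo \<open>p q\<^sup>n\<close>; read from left to right, it then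
  recovers all floors from \<open>m 0\<close>.\<close>

lemma floors_mod_inj:
  assumes N: "N < p ^ n * q ^ n" "N' < p ^ n * q ^ n"
    and eq: "map (\<lambda>m. m mod (p * q)) (floors n N) = map (\<lambda>m. m mod (p * q)) (floors n N')"
  shows "floors n N = floors n N'"
proof (cases "n = 0")
  case False
  define m m' where "m k = N div divisor n k" and "m' k = N' div divisor n k" for k
  have res: "m k mod (p * q) = m' k mod (p * q)" if "k < n" for k
    using eq that by (simp add: floors_def m_def m'_def)
  have resp: "m k mod p = m' k mod p" and resq: "m k mod q = m' k mod q" if "k < n" for k
    using res[OF that] by (metis dvd_triv_left dvd_triv_right mod_mod_cancel)+
  have rec: "m (Suc k) div p = m k div q" "m' (Suc k) div p = m' k div q" if "Suc k < n" for k
    using divisor_Suc that by (auto simp: m_def m'_def)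
  have down: "m (n - 1 - j) mod (p * q ^ Suc j) = m' (n - 1 - j) mod (p * q ^ Suc j)" if "j < n" for j
    using that
  proof (induction j)
    case 0
    then show ?case using res by simp
  next
    case (Suc j)
    define k where "k = n - 1 - Suc j"
    have k: "Suc k < n" "n - 1 - j = Suc k" using Suc.prems by (auto simp: k_def)
    have "m (Suc k) mod (p * q ^ Suc j) = m' (Suc k) mod (p * q ^ Suc j)"
      using Suc k by simp
    moreover have "a mod (p * q ^ Suc j) div p = a div p mod q ^ Suc j" for a
      using p_gt_1 by (simp add: mod_mult2_eq)
    ultimately have "m k div q mod q ^ Suc j = m' k div q mod q ^ Suc j"
      using rec[OF k(1)] by metis
    \<comment> \<open>The residue modulo \<open>q\<close> supplies the lowest base \<open>q\<close>
      digit; the residue modulo \<open>p\<close> is then joined by the Chinese remainder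
      theorem.\<close>
    then have "m k mod (q * q ^ Suc j) = m' k mod (q * q ^ Suc j)"
      using resq[of k] k by (simp add: mod_mult2_eq)
    moreover have "coprime p (q * q ^ Suc j)" using coprime by simp
    moreover have "m k mod p = m' k mod p" using resp k by simp
    ultimately have "[m k = m' k] (mod p * (q * q ^ Suc j))"
      using coprime_cong_mult_nat[of "m k" "m' k" p "q * q ^ Suc j"] unfolding cong_def by blast
    then show ?case by (simp add: cong_def k_def)
  qed
  have m0: "m 0 mod (p * q ^ n) = m' 0 mod (p * q ^ n)"
    using down[of "n - 1"] False by simp
  \<comment> \<open>The bound on \<open>N\<close> puts \<open>m 0\<close> below the modulus
    \<open>p * q ^ n\<close>, so its residue is its value.\<close>
  have M: "p ^ n * q ^ n = p * q ^ n * divisor n 0"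
    using False by (cases n) (auto simp: divisor_def)
  then have "m 0 < p * q ^ n" "m' 0 < p * q ^ n"
    using N less_mult_imp_div_less unfolding m_def m'_def M by blast+
  then have "m 0 = m' 0" using m0 by simp
  have "m k = m' k" if "k < n" for k
    using that
  proof (induction k)
    case (Suc k)
    then show ?case using resp[of "Suc k"] rec[of k] by (metis Suc_lessD div_mult_mod_eq)
  qed (use \<open>m 0 = m' 0\<close> in simp)
  then show ?thesis by (simp add: floors_def m_def m'_def)
qed (simp add: floors_def)

section \<open>Counting the jump points of the floors\<close>

definition breaks :: "nat \<Rightarrow> nat set" where
  "breaks n = {N. \<exists>k<n. divisor n k dvd N}"

lemma floors_eqD: "floors n N = floors n N' \<Longrightarrow> k < n \<Longrightarrow> N div divisor n k = N' div divisor n k"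
  by (simp add: floors_def)

text \<open>The list of floors is constant between consecutive break points and changes at each of
  them, so each list has exactly one break point as its first occurrence.\<close>

lemma card_floors:
  assumes "n > 0"
  shows "card (floors n ` {..<M}) = card (breaks n \<inter> {..<M})"
proof -
  have less: "floors n N \<noteq> floors n N'" if N: "N < N'" "N' \<in> breaks n" for N N'
  proof
    assume eq: "floors n N = floors n N'"
    obtain k where k: "k < n" "divisor n k dvd N'" using N by (auto simp: breaks_def)
    then have "N' = divisor n k * (N div divisor n k)" using floors_eqD[OF eq k(1)] by simp
    also have "\<dots> \<le> N" by simp
    finally show False using N by simp
  qed
  have "inj_on (floors n) (breaks n \<inter> {..<M})"
    by (rule inj_onI) (metis IntD1 less linorder_neqE_nat)
  moreover have "floors n ` {..<M} = floors n ` (breaks n \<inter> {..<M})"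
  proof (intro equalityI image_subsetI)
    fix N assume N: "N \<in> {..<M}"
    \<comment> \<open>\<open>Max B\<close> is the last break point up to \<open>N\<close>; no floor
      jumps between it and \<open>N\<close>.\<close>
    define B where "B = breaks n \<inter> {..N}"
    have fin: "finite B" by (simp add: B_def)
    have "0 \<in> B" using assms by (auto simp: B_def breaks_def)
    then have max: "Max B \<in> B" using fin by (intro Max_in) auto
    have "N div divisor n k = Max B div divisor n k" if "k < n" for k
    proof (rule antisym)
      \<comment> \<open>The largest multiple of \<open>divisor n k\<close> up to \<open>N\<close> is
        itself a break point.\<close>
      have "divisor n k * (N div divisor n k) \<in> B"
        using that by (auto simp: B_def breaks_def)
      then have "divisor n k * (N div divisor n k) \<le> Max B" using fin by simp
      then show "N div divisor n k \<le> Max B div divisor n k"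
        using divisor_pos by (simp add: less_eq_div_iff_mult_less_eq mult.commute)
      show "Max B div divisor n k \<le> N div divisor n k"
        using max by (auto simp: B_def intro: div_le_mono)
    qed
    then have "floors n N = floors n (Max B)" by (simp add: floors_def)
    moreover have "Max B \<in> breaks n \<inter> {..<M}" using max N by (auto simp: B_def)
    ultimately show "floors n N \<in> floors n ` (breaks n \<inter> {..<M})" by blast
  qed auto
  ultimately show ?thesis by (simp add: card_image)
qed

lemma card_periodic:
  fixes M c :: nat
  assumes "\<And>a. a + M \<in> B \<longleftrightarrow> a \<in> B"
  shows "card (B \<inter> {..<c * M}) = c * card (B \<inter> {..<M})"
proof (induction c)
  case (Suc c)
  have shift: "a + c * M \<in> B \<longleftrightarrow> a \<in> B" for a c
  proof (induction c)
    case (Suc c)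
    then show ?case using assms[of "a + c * M"] by (simp add: algebra_simps)
  qed simp
  have "B \<inter> {..<Suc c * M} = (B \<inter> {..<c * M}) \<union> (\<lambda>a. a + c * M) ` (B \<inter> {..<M})"
  proof (intro equalityI subsetI)
    fix x assume x: "x \<in> B \<inter> {..<Suc c * M}"
    show "x \<in> (B \<inter> {..<c * M}) \<union> (\<lambda>a. a + c * M) ` (B \<inter> {..<M})"
    proof (cases "x < c * M")
      case False
      then have "x = (x - c * M) + c * M" by simp
      moreover have "x - c * M \<in> B \<inter> {..<M}"
        using x False shift[of "x - c * M" c] by auto
      ultimately show ?thesis by blast
    qed (use x in auto)
  qed (auto simp: shift)
  moreover have "card ((\<lambda>a. a + c * M) ` (B \<inter> {..<M})) = card (B \<inter> {..<M})"
    by (rule card_image) (auto simp: inj_on_def)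
  moreover have "(B \<inter> {..<c * M}) \<inter> (\<lambda>a. a + c * M) ` (B \<inter> {..<M}) = {}" by auto
  ultimately show ?case using Suc by (simp add: card_Un_disjoint)
qed simp

text \<open>The divisors for \<open>Suc n\<close> are \<open>p ^ n\<close> and \<open>q\<close>
  times those for \<open>n\<close>. A multiple of \<open>p ^ n\<close> whose cofactor is divisible
  by \<open>q\<close> already lies in the first set, because \<open>p ^ (n - 1)\<close> is a divisor
  for \<open>n\<close>.\<close>

lemma breaks_Suc:
  assumes "n > 0"
  shows "breaks (Suc n) = ((*) q) ` breaks n \<union> ((*) (p ^ n)) ` {j. \<not> q dvd j}"
    (is "_ = ?A \<union> ?B")
proof -
  have div0: "divisor (Suc n) 0 = p ^ n" and divS: "divisor (Suc n) (Suc k) = q * divisor n k" for k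
    by (simp_all add: divisor_def)
  show ?thesis
  proof (intro equalityI subsetI)
    fix N assume "N \<in> breaks (Suc n)"
    then obtain k where k: "k < Suc n" "divisor (Suc n) k dvd N" by (auto simp: breaks_def)
    show "N \<in> ?A \<union> ?B"
    proof (cases k)
      case 0
      then obtain j where j: "N = p ^ n * j" using k div0 by auto
      show ?thesis
      proof (cases "q dvd j")
        case True
        then obtain i where "j = q * i" by blast
        then have "N = q * (p ^ n * i)" using j by simp
        moreover have "p ^ n * i \<in> breaks n"
          using assms by (auto simp: breaks_def divisor_def intro!: exI[of _ 0] dvd_mult2 le_imp_power_dvd)
        ultimately show ?thesis by blast
      qed (use j in auto)
    next
      case (Suc i)
      then obtain c where "N = q * (divisor n i * c)" using k divS by (metis dvdE mult.assoc)
      moreover have "divisor n i * c \<in> breaks n" using k Suc by (auto simp: breaks_def)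
      ultimately show ?thesis by blast
    qed
  next
    fix N assume "N \<in> ?A \<union> ?B"
    then show "N \<in> breaks (Suc n)"
    proof
      assume "N \<in> ?A"
      then obtain k a where k: "k < n" "divisor n k dvd a" "N = q * a" by (auto simp: breaks_def)
      then have "Suc k < Suc n" "divisor (Suc n) (Suc k) dvd N" by (simp_all add: divS)
      then show ?thesis unfolding breaks_def by blast
    next
      assume "N \<in> ?B"
      then have "divisor (Suc n) 0 dvd N" by (auto simp: div0)
      then show ?thesis unfolding breaks_def by blast
    qed
  qed
qed

text \<open>The two sets of \<open>breaks_Suc\<close> are disjoint by coprimality. Below the bound,
  the first covers \<open>p\<close> periods of \<open>breaks n\<close>, which gives the factor
  \<open>p\<close>.\<close>

lemma card_breaks_Suc:
  assumes "n > 0"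
  shows "card (breaks (Suc n) \<inter> {..<p ^ Suc n * q ^ Suc n}) =
    p * card (breaks n \<inter> {..<p ^ n * q ^ n}) + (q - 1) * (p * q ^ n)"
proof -
  let ?M = "p ^ Suc n * q ^ Suc n"
  have pos: "p > 0" "q > 0" "p ^ n > 0" using p_gt_1 q_gt_1 by auto
  define A where "A = ((*) q) ` (breaks n \<inter> {..<p * (p ^ n * q ^ n)})"
  define J where "J = {j. \<not> q dvd j} \<inter> {..<p * q ^ n * q}"
  define B where "B = ((*) (p ^ n)) ` J"
  have "?M = q * (p * (p ^ n * q ^ n))" and M: "?M = p ^ n * (p * q ^ n * q)"
    by (simp_all add: mult_ac)
  then have "q * a < ?M \<longleftrightarrow> a < p * (p ^ n * q ^ n)" "p ^ n * j < ?M \<longleftrightarrow> j < p * q ^ n * q" for a j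
    using pos by (metis nat_mult_less_cancel1)+
  then have "(*) q ` X \<inter> {..<?M} = (*) q ` (X \<inter> {..<p * (p ^ n * q ^ n)})"
    "(*) (p ^ n) ` X \<inter> {..<?M} = (*) (p ^ n) ` (X \<inter> {..<p * q ^ n * q})" for X
    by blast+
  then have eq: "breaks (Suc n) \<inter> {..<?M} = A \<union> B"
    unfolding breaks_Suc[OF assms] A_def B_def J_def Int_Un_distrib2 by simp
  have "q dvd N" if "N \<in> A" for N using that by (auto simp: A_def)
  moreover have "\<not> q dvd N" if "N \<in> B" for N
    using that coprime by (auto simp: B_def J_def coprime_dvd_mult_right_iff coprime_commute)
  ultimately have disj: "A \<inter> B = {}" by blast
  have period: "a + p ^ n * q ^ n \<in> breaks n \<longleftrightarrow> a \<in> breaks n" for a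
  proof -
    have "divisor n k dvd a + p ^ n * q ^ n \<longleftrightarrow> divisor n k dvd a" if "k < n" for k
      using divisor_dvd[OF that] by (metis dvd_add_left_iff dvd_mult_left)
    then show ?thesis by (auto simp: breaks_def)
  qed
  have "card A = card (breaks n \<inter> {..<p * (p ^ n * q ^ n)})"
    unfolding A_def using pos by (intro card_image) (auto simp: inj_on_def)
  then have cA: "card A = p * card (breaks n \<inter> {..<p ^ n * q ^ n})"
    using card_periodic[OF period] by simp
  \<comment> \<open>\<open>J\<close> consists of \<open>p * q ^ n\<close> blocks of length
    \<open>q\<close>, each with \<open>q - 1\<close> non-multiples of \<open>q\<close>.\<close>
  have "{j. \<not> q dvd j} \<inter> {..<q} = {1..<q}"
    using pos by (auto dest: dvd_imp_le intro: Nat.gr0I simp: Suc_le_eq)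
  then have "card J = p * q ^ n * (q - 1)"
    unfolding J_def by (subst card_periodic) simp_all
  then have cB: "card B = (q - 1) * (p * q ^ n)"
    unfolding B_def using pos by (subst card_image) (auto simp: inj_on_def)
  show ?thesis
    unfolding eq using cA cB disj by (subst card_Un_disjoint) (auto simp: A_def B_def J_def)
qed

text \<open>Length 0 is separate: \<open>breaks 0\<close> is empty, but the empty word counts
  once.\<close>

lemma complexity_trace:
  "complexity (trace_subshift p q) n =
     (if n = 0 then 1 else card (breaks n \<inter> {..<p ^ n * q ^ n}))"
proof -
  have "inj_on (map (\<lambda>m. m mod (p * q))) (floors n ` {..<p ^ n * q ^ n})"
    using floors_mod_inj by (auto intro!: inj_onI)
  then have "complexity (trace_subshift p q) n = card (floors n ` {..<p ^ n * q ^ n})"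
    unfolding complexity_def language_trace_subshift trace_words
    by (simp add: card_image flip: image_image)
  moreover have "floors 0 ` {..<p ^ 0 * q ^ 0} = {[]}" by (auto simp: floors_def)
  ultimately show ?thesis by (simp add: card_floors)
qed

lemma complexity_trace_rec:
  "complexity (trace_subshift p q) 0 = 1"
  "complexity (trace_subshift p q) (Suc 0) = p * q"
  "n > 0 \<Longrightarrow> complexity (trace_subshift p q) (Suc n) =
     p * complexity (trace_subshift p q) n + (q - 1) * (p * q ^ n)"
proof -
  have "breaks (Suc 0) = UNIV" by (auto simp: breaks_def divisor_def)
  then show "complexity (trace_subshift p q) (Suc 0) = p * q" by (simp add: complexity_trace)
qed (use card_breaks_Suc in \<open>simp_all add: complexity_trace\<close>)


section \<open>A sofic shift with the same complexity\<close>

text \<open>Letters are residues modulo \<open>p q\<close>. The sequences of differences in \<open>Z\<close> lie in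
  \<open>Q\<^sup>* P\<^sup>*\<close> for sets \<open>Q = {0..<q}\<close> and \<open>P = {0} \<union> {q..<p + q - 1}\<close> of \<open>q\<close> and \<open>p\<close> residues;
  since \<open>P\<close> and \<open>Q\<close> share one element, the words of \<open>Z\<close> satisfy the recursion of
  \<open>complexity_trace_rec\<close>.\<close>

definition diff :: "nat \<Rightarrow> nat \<Rightarrow> nat" where
  "diff a c = (c + (p * q - a)) mod (p * q)"

definition P :: "nat set" where "P = insert 0 {q..<p + q - 1}"

text \<open>The bound puts every difference into the union of the two sets, and the second clause
  forbids leaving \<open>P\<close> after a difference outside \<open>Q\<close>. Stated for pairs of
  positions, \<open>Q\<^sup>* P\<^sup>*\<close> becomes a closed shift-invariant condition.\<close>

definition Z :: "(int \<Rightarrow> nat) set" where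
  "Z = {z \<in> S. (\<forall>i. diff (z i) (z (i + 1)) < p + q - 1) \<and>
     (\<forall>i j. i < j \<longrightarrow> q \<le> diff (z i) (z (i + 1)) \<longrightarrow> diff (z j) (z (j + 1)) \<in> P)}"

definition low :: "nat list \<Rightarrow> bool" where
  "low w \<longleftrightarrow> (\<forall>i. Suc i < length w \<longrightarrow> diff (w ! i) (w ! Suc i) < q)"

definition admissible :: "nat list \<Rightarrow> bool" where
  "admissible w \<longleftrightarrow> (\<forall>i. Suc i < length w \<longrightarrow> diff (w ! i) (w ! Suc i) < p + q - 1) \<and>
     (\<forall>i j. i < j \<longrightarrow> Suc j < length w \<longrightarrow> q \<le> diff (w ! i) (w ! Suc i) \<longrightarrow>
        diff (w ! j) (w ! Suc j) \<in> P)"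

lemma diff_self: "a < p * q \<Longrightarrow> diff a a = 0"
  by (simp add: diff_def)

text \<open>\<open>diff a\<close> is subtraction of \<open>a\<close> modulo \<open>p * q\<close>,
  with \<open>p * q - a\<close> standing for \<open>-a\<close>. Prescribing the next difference thus
  amounts to prescribing the next letter.\<close>

lemma bij_diff:
  assumes "a < p * q"
  shows "bij_betw (diff a) {..<p * q} {..<p * q}"
proof -
  have "inj_on (diff a) {..<p * q}"
  proof (rule inj_onI)
    fix c d assume cd: "c \<in> {..<p * q}" "d \<in> {..<p * q}" "diff a c = diff a d"
    then have "[c + (p * q - a) = d + (p * q - a)] (mod p * q)" by (simp add: diff_def cong_def)
    then have "[c = d] (mod p * q)" by (simp add: cong_add_rcancel_nat)
    then show "c = d" using cd by (simp add: cong_def)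
  qed
  moreover have "diff a ` {..<p * q} \<subseteq> {..<p * q}"
    using p_gt_1 q_gt_1 by (auto simp: diff_def)
  ultimately show ?thesis by (simp add: bij_betw_def endo_inj_surj)
qed

lemma card_diff:
  assumes "a < p * q" "D \<subseteq> {..<p * q}"
  shows "card {c \<in> {..<p * q}. diff a c \<in> D} = card D"
proof -
  note b = bij_diff[OF assms(1)]
  have "diff a ` {c \<in> {..<p * q}. diff a c \<in> D} = D"
    using b assms(2) by (auto simp: bij_betw_def image_iff)
  moreover have "inj_on (diff a) {c \<in> {..<p * q}. diff a c \<in> D}"
    using b by (auto simp: bij_betw_def inj_on_def)
  ultimately show ?thesis by (metis card_image)
qed

lemma pq_bounds: "p + q - 1 \<le> p * q" "q \<le> p + q - 1"
proof -
  obtain a b where "p = Suc a" "q = Suc b" using p_gt_1 q_gt_1 by (metis Suc_pred less_imp_Suc_add)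
  then show "p + q - 1 \<le> p * q" "q \<le> p + q - 1" by simp_all
qed

lemma diff_snoc:
  assumes "w \<noteq> []" "Suc i < length (w @ [c])"
  shows "diff ((w @ [c]) ! i) ((w @ [c]) ! Suc i) =
    (if Suc i < length w then diff (w ! i) (w ! Suc i) else diff (last w) c)"
proof (cases "Suc i < length w")
  case False
  then have "i = length w - 1" using assms by auto
  then show ?thesis using assms False by (simp add: nth_append last_conv_nth)
qed (simp add: nth_append)

lemma low_snoc:
  assumes "w \<noteq> []"
  shows "low (w @ [c]) \<longleftrightarrow> low w \<and> diff (last w) c < q"
proof -
  define e where "e i = diff (w ! i) (w ! Suc i)" for i
  define l where "l = diff (last w) c"
  define m where "m = length w - 1"
  have m: "length w = Suc m" using assms by (simp add: m_def)
  have e: "diff ((w @ [c]) ! i) ((w @ [c]) ! Suc i) = (if i < m then e i else l)" if "i < Suc m" for i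
    using diff_snoc[OF assms, of i c] that by (simp add: e_def l_def m)
  have low: "low w \<longleftrightarrow> (\<forall>i<m. e i < q)" by (simp add: low_def e_def m)
  have "low (w @ [c]) \<longleftrightarrow> (\<forall>i<Suc m. (if i < m then e i else l) < q)"
    unfolding low_def using e by (simp add: m)
  also have "\<dots> \<longleftrightarrow> low w \<and> l < q"
    unfolding low by (auto simp: less_Suc_eq)
  finally show ?thesis unfolding l_def .
qed

text \<open>A difference in \<open>P\<close> may always follow; any other must lie below
  \<open>q\<close> and needs all earlier ones below \<open>q\<close>.\<close>

lemma admissible_snoc:
  assumes "w \<noteq> []"
  shows "admissible (w @ [c]) \<longleftrightarrow>
    admissible w \<and> (diff (last w) c \<in> P \<or> (low w \<and> diff (last w) c < q))"
proof -
  define e where "e i = diff (w ! i) (w ! Suc i)" for i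
  define l where "l = diff (last w) c"
  define m where "m = length w - 1"
  have m: "length w = Suc m" using assms by (simp add: m_def)
  have e: "diff ((w @ [c]) ! i) ((w @ [c]) ! Suc i) = (if i < m then e i else l)" if "i < Suc m" for i
    using diff_snoc[OF assms, of i c] that by (simp add: e_def l_def m)
  have low: "low w \<longleftrightarrow> (\<forall>i<m. e i < q)" by (simp add: low_def e_def m)
  have adm: "admissible w \<longleftrightarrow> (\<forall>i<m. e i < p + q - 1) \<and>
      (\<forall>i j. i < j \<longrightarrow> j < m \<longrightarrow> q \<le> e i \<longrightarrow> e j \<in> P)"
    by (simp add: admissible_def e_def m)
  have "admissible (w @ [c]) \<longleftrightarrow> (\<forall>i<Suc m. (if i < m then e i else l) < p + q - 1) \<and>
      (\<forall>i j. i < j \<longrightarrow> j < Suc m \<longrightarrow> q \<le> (if i < m then e i else l) \<longrightarrow>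
        (if j < m then e j else l) \<in> P)"
    unfolding admissible_def using e by (simp add: m)
  also have "\<dots> \<longleftrightarrow> admissible w \<and> l < p + q - 1 \<and> ((\<exists>i<m. q \<le> e i) \<longrightarrow> l \<in> P)"
    unfolding adm by (auto simp: less_Suc_eq)
  also have "\<dots> \<longleftrightarrow> admissible w \<and> (l \<in> P \<or> (low w \<and> l < q))"
    using pq_bounds p_gt_1 q_gt_1 by (auto simp: low P_def not_le)
  finally show ?thesis unfolding l_def .
qed

lemma low_imp_admissible: "low w \<Longrightarrow> admissible w"
  using pq_bounds(2) unfolding low_def admissible_def by (meson leD less_le_trans less_trans Suc_lessD Suc_mono)

lemma language_Z: "language Z = {w \<in> lists {..<p * q}. admissible w}"
proof (intro equalityI subsetI)
  fix w assume "w \<in> language Z"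
  then obtain z i n where z: "z \<in> Z" and w: "w = map (\<lambda>j. z (i + int j)) [0..<n]"
    by (auto simp: language_def)
  have d: "diff (w ! j) (w ! Suc j) = diff (z (i + int j)) (z (i + int j + 1))"
    if "Suc j < length w" for j
    using that by (simp add: w ac_simps)
  have z: "z \<in> S" "diff (z k) (z (k + 1)) < p + q - 1"
    "k < l \<Longrightarrow> q \<le> diff (z k) (z (k + 1)) \<Longrightarrow> diff (z l) (z (l + 1)) \<in> P" for k l
    using z unfolding Z_def by blast+
  have "admissible w"
    unfolding admissible_def
  proof (intro conjI allI impI)
    fix j assume "Suc j < length w"
    then show "diff (w ! j) (w ! Suc j) < p + q - 1" using z(2) by (simp only: d)
  next
    fix j k assume jk: "j < k" "Suc k < length w" "q \<le> diff (w ! j) (w ! Suc j)"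
    then have "Suc j < length w" "i + int j < i + int k" by simp_all
    then show "diff (w ! k) (w ! Suc k) \<in> P" using jk d z(3) by metis
  qed
  moreover have "w \<in> lists {..<p * q}" using z(1) by (auto simp: w full_shift_def)
  ultimately show "w \<in> {w \<in> lists {..<p * q}. admissible w}" by simp
next
  fix w assume "w \<in> {w \<in> lists {..<p * q}. admissible w}"
  then have w: "set w \<subseteq> {..<p * q}" "admissible w" by auto
  text \<open>Extending a word by constants only adds the difference 0, which lies in both sets.\<close>
  define z where "z i = (if w = [] then 0 else w ! min (nat i) (length w - 1))" for i
  have zA: "z i \<in> {..<p * q}" for i
  proof (cases "w = []")
    case False
    then have "min (nat i) (length w - 1) < length w" by (simp add: min_less_iff_disj)
    then have "w ! min (nat i) (length w - 1) \<in> set w" by (rule nth_mem)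
    then show ?thesis using w(1) False by (auto simp: z_def)
  qed (use p_gt_1 q_gt_1 in \<open>simp add: z_def\<close>)
  have d: "diff (z i) (z (i + 1)) =
    (if 0 \<le> i \<and> Suc (nat i) < length w then diff (w ! nat i) (w ! Suc (nat i)) else 0)" for i
  proof (cases "0 \<le> i \<and> Suc (nat i) < length w")
    case True
    then have "nat (i + 1) = Suc (nat i)" by auto
    then show ?thesis using True by (auto simp: z_def min_def)
  next
    case False
    \<comment> \<open>Off the word, both positions are clamped to the same end.\<close>
    then have "min (nat (i + 1)) (length w - 1) = min (nat i) (length w - 1)" by linarith
    then have "z (i + 1) = z i" by (simp add: z_def)
    then show ?thesis using False zA[of i] by (auto simp: diff_self)
  qed
  have "diff (z i) (z (i + 1)) < p + q - 1" for i
    using w(2) q_gt_1 unfolding d admissible_def by simp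
  moreover have "diff (z j) (z (j + 1)) \<in> P" if "i < j" "q \<le> diff (z i) (z (i + 1))" for i j
  proof (cases "Suc (nat j) < length w")
    case True
    have i: "0 \<le> i" "q \<le> diff (w ! nat i) (w ! Suc (nat i))"
      using that(2) q_gt_1 unfolding d by (auto split: if_splits)
    then have "nat i < nat j" using that(1) by simp
    then have "diff (w ! nat j) (w ! Suc (nat j)) \<in> P"
      using w(2) True i(2) unfolding admissible_def by blast
    then show ?thesis by (simp add: d P_def)
  qed (simp add: d P_def)
  ultimately have "z \<in> Z" using zA unfolding Z_def full_shift_def by blast
  moreover have "w = map (\<lambda>j. z (0 + int j)) [0..<length w]"
    by (rule nth_equalityI) (auto simp: z_def min_def)
  ultimately show "w \<in> language Z" using language_wordI[of z Z 0 "length w"] by simp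
qed

section \<open>Counting the words of \<open>Z\<close>\<close>

definition words :: "nat \<Rightarrow> nat list set" where
  "words n = {w \<in> lists {..<p * q}. length w = n}"

lemma finite_words: "finite (words n)"
proof -
  have "words n = {w. set w \<subseteq> {..<p * q} \<and> length w = n}" by (auto simp: words_def)
  then show ?thesis by (simp add: finite_lists_length_eq)
qed

lemma card_snoc:
  assumes "X \<subseteq> words n" "n > 0" "D \<subseteq> {..<p * q}"
  shows "card {w @ [c] | w c. w \<in> X \<and> c < p * q \<and> diff (last w) c \<in> D} = card X * card D"
proof -
  have eq: "{w @ [c] | w c. w \<in> X \<and> c < p * q \<and> diff (last w) c \<in> D} =
      (\<lambda>(w, c). w @ [c]) ` (SIGMA w:X. {c \<in> {..<p * q}. diff (last w) c \<in> D})"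
    by auto
  have "last w < p * q" if "w \<in> X" for w
    using that assms last_in_set[of w] by (fastforce simp: words_def)
  then have "card (SIGMA w:X. {c \<in> {..<p * q}. diff (last w) c \<in> D}) = card X * card D"
    using finite_subset[OF assms(1) finite_words] card_diff[OF _ assms(3)] by simp
  then show ?thesis unfolding eq by (subst card_image) (auto simp: inj_on_def)
qed

lemma words_Suc_cases:
  "{w \<in> words (Suc n). R w} = {w @ [c] | w c. w \<in> words n \<and> c < p * q \<and> R (w @ [c])}"
proof (intro equalityI subsetI)
  fix v assume v: "v \<in> {w \<in> words (Suc n). R w}"
  then obtain w c where "v = w @ [c]" by (cases v rule: rev_cases) (auto simp: words_def)
  then show "v \<in> {w @ [c] | w c. w \<in> words n \<and> c < p * q \<and> R (w @ [c])}"
    using v by (auto simp: words_def)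
qed (auto simp: words_def)

lemma card_words_1: "card (words (Suc 0)) = p * q"
proof -
  have "words (Suc 0) = (\<lambda>c. [c]) ` {..<p * q}" by (auto simp: words_def length_Suc_conv)
  moreover have "inj_on (\<lambda>c. [c]) {..<p * q}" by (simp add: inj_on_def)
  ultimately show ?thesis by (simp add: card_image)
qed

lemma words_nonempty: "w \<in> words n \<Longrightarrow> n > 0 \<Longrightarrow> w \<noteq> []"
  by (auto simp: words_def)

text \<open>There are \<open>p * q\<close> first letters and \<open>q\<close> choices for each of
  the \<open>n - 1\<close> differences.\<close>

lemma card_low: "n > 0 \<Longrightarrow> card {w \<in> words n. low w} = p * q ^ n"
proof (induction n)
  case (Suc n)
  show ?case
  proof (cases "n = 0")
    case True
    then have "{w \<in> words (Suc n). low w} = words (Suc 0)" by (auto simp: words_def low_def)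
    then show ?thesis using True card_words_1 by simp
  next
    case False
    then have "{w \<in> words (Suc n). low w} =
        {w @ [c] | w c. w \<in> {w \<in> words n. low w} \<and> c < p * q \<and> diff (last w) c \<in> {..<q}}"
      unfolding words_Suc_cases using low_snoc words_nonempty by blast
    then show ?thesis
      using card_snoc[of "{w \<in> words n. low w}" n "{..<q}"] False Suc p_gt_1 by simp
  qed
qed simp

lemma complexity_Z: "complexity Z n = card {w \<in> words n. admissible w}"
  unfolding complexity_def language_Z words_def by (rule arg_cong[of _ _ card]) auto

lemma complexity_Z_rec:
  "complexity Z 0 = 1"
  "complexity Z (Suc 0) = p * q"
  "n > 0 \<Longrightarrow> complexity Z (Suc n) = p * complexity Z n + (q - 1) * (p * q ^ n)"
proof -
  have "{w \<in> words 0. admissible w} = {[]}" by (auto simp: words_def admissible_def)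
  then show "complexity Z 0 = 1" by (simp add: complexity_Z)
  have "{w \<in> words (Suc 0). admissible w} = words (Suc 0)" by (auto simp: words_def admissible_def)
  then show "complexity Z (Suc 0) = p * q" by (simp add: complexity_Z card_words_1)
  assume n: "n > 0"
  define ext where "ext X D = {w @ [c] | w c. w \<in> X \<and> c < p * q \<and> diff (last w) c \<in> D}" for X D
  let ?A = "{w \<in> words n. admissible w}" and ?L = "{w \<in> words n. low w}"
  \<comment> \<open>The shared difference 0 is assigned to \<open>P\<close>. This leaves
    \<open>q - 1\<close> further differences after low words and makes the two cases
    disjoint.\<close>
  have "admissible (w @ [c]) \<longleftrightarrow> admissible w \<and> diff (last w) c \<in> P \<or>
      low w \<and> diff (last w) c \<in> {1..<q}" if "w \<in> words n" for w c
  proof -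
    have "diff (last w) c < q \<longleftrightarrow> diff (last w) c = 0 \<or> diff (last w) c \<in> {1..<q}"
      using q_gt_1 by auto
    then show ?thesis
      using admissible_snoc[OF words_nonempty[OF that n]] low_imp_admissible[of w]
      by (auto simp: P_def)
  qed
  then have "{w \<in> words (Suc n). admissible w} = ext ?A P \<union> ext ?L {1..<q}"
    unfolding words_Suc_cases ext_def by blast
  moreover have "ext ?A P \<inter> ext ?L {1..<q} = {}" by (auto simp: ext_def P_def)
  moreover have "finite (ext X D)" if "X \<subseteq> words n" for X D
    by (rule finite_subset[OF _ finite_words[of "Suc n"]]) (use that in \<open>fastforce simp: ext_def words_def\<close>)
  ultimately have "complexity Z (Suc n) = card (ext ?A P) + card (ext ?L {1..<q})"
    unfolding complexity_Z by (simp only: card_Un_disjoint Collect_subset simp_thms)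
  moreover have "card (ext X D) = card X * card D" if "X \<subseteq> words n" "D \<subseteq> {..<p * q}" for X D
    unfolding ext_def using card_snoc[OF that(1) n that(2)] .
  moreover have "P \<subseteq> {..<p * q}" "{1..<q} \<subseteq> {..<p * q}"
    using pq_bounds p_gt_1 q_gt_1 by (auto simp: P_def)
  moreover have "card P = p" using p_gt_1 q_gt_1 by (simp add: P_def)
  ultimately show "complexity Z (Suc n) = p * complexity Z n + (q - 1) * (p * q ^ n)"
    using card_low[OF n] by (simp only: complexity_Z Collect_subset card_atLeastLessThan mult.commute)
qed

lemma complexity_Z_eq_trace: "complexity Z n = complexity (trace_subshift p q) n"
proof (induction n rule: nat_induct)
  case (Suc n)
  then show ?case
    by (cases "n = 0") (simp_all only: complexity_Z_rec complexity_trace_rec neq0_conv)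
qed (simp only: complexity_Z_rec complexity_trace_rec)

text \<open>The automaton remembers the last letter \<open>a\<close>: the state is \<open>1 + a\<close> as long as all differences
  lie in \<open>Q\<close>, it is \<open>1 + p q + a\<close> for the other admissible words, and \<open>1 + 2 p q\<close> is the sink.\<close>

definition \<delta> :: "nat \<Rightarrow> nat \<Rightarrow> nat" where
  "\<delta> s c = (if s = 0 then 1 + c
     else if s \<le> p * q \<and> diff (s - 1) c < q then 1 + c
     else if s \<le> 2 * (p * q) \<and> diff ((s - 1) mod (p * q)) c \<in> P then 1 + p * q + c
     else 1 + 2 * (p * q))"

text \<open>The transitions follow \<open>low_snoc\<close> and \<open>admissible_snoc\<close>; in
  both blocks of states, \<open>(s - 1) mod (p * q)\<close> recovers the last letter.\<close>

lemma foldl_\<delta>: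
  "set w \<subseteq> {..<p * q} \<Longrightarrow> foldl \<delta> 0 w =
     (if w = [] then 0 else if low w then 1 + last w
      else if admissible w then 1 + p * q + last w else 1 + 2 * (p * q))"
proof (induction w rule: rev_induct)
  case (snoc c w)
  show ?case
  proof (cases "w = []")
    case True
    then show ?thesis by (simp add: \<delta>_def low_def)
  next
    case False
    then have "last w \<in> set w" by simp
    then have l: "last w < p * q" using snoc.prems by auto
    then show ?thesis
      using snoc False low_snoc[OF False, of c] admissible_snoc[OF False, of c]
        low_imp_admissible[of w]
      by (auto simp: \<delta>_def)
  qed
qed simp

lemma regular_Z: "regular_language {..<p * q} (language Z)"
  unfolding regular_language_def
proof (intro exI conjI)
  show "finite {..1 + 2 * (p * q)}" "0 \<in> {..1 + 2 * (p * q)}"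
    "{..2 * (p * q)} \<subseteq> {..1 + 2 * (p * q)}" by auto
  show "\<forall>s\<in>{..1 + 2 * (p * q)}. \<forall>a\<in>{..<p * q}. \<delta> s a \<in> {..1 + 2 * (p * q)}"
    by (auto simp: \<delta>_def)
  have "foldl \<delta> 0 w \<in> {..2 * (p * q)} \<longleftrightarrow> admissible w" if w: "w \<in> lists {..<p * q}" for w
  proof (cases "w = []")
    case True
    then show ?thesis by (simp add: admissible_def)
  next
    case False
    then have "last w \<in> set w" by simp
    then have "last w < p * q" using w by auto
    moreover have "set w \<subseteq> {..<p * q}" using w by auto
    ultimately show ?thesis using False low_imp_admissible[of w] by (auto simp: foldl_\<delta>)
  qed
  then show "language Z = {w \<in> lists {..<p * q}. foldl \<delta> 0 w \<in> {..2 * (p * q)}}"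
    unfolding language_Z by blast
qed

section \<open>Shift invariance, closedness and soficity\<close>

lemma shift_Z: "shift_map ` Z = Z"
proof -
  have shifted: "(\<lambda>i. z (i + k)) \<in> Z" if z: "z \<in> Z" for z k
  proof -
    have "diff (z (i + k)) (z (i + 1 + k)) = diff (z (i + k)) (z (i + k + 1))" for i
      by (simp add: ac_simps)
    moreover have "\<forall>i j. i + k < j + k \<longrightarrow> q \<le> diff (z (i + k)) (z (i + k + 1)) \<longrightarrow>
        diff (z (j + k)) (z (j + k + 1)) \<in> P"
      using z unfolding Z_def by blast
    ultimately show ?thesis using z by (simp add: Z_def full_shift_def)
  qed
  show ?thesis
  proof (intro equalityI subsetI)
    fix z assume "z \<in> Z"
    then have "z = shift_map (\<lambda>i. z (i + (- 1)))" "(\<lambda>i. z (i + (- 1))) \<in> Z"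
      using shifted[of z "- 1"] by (auto simp: shift_map_def)
    then show "z \<in> shift_map ` Z" by blast
  qed (use shifted[of _ 1] in \<open>auto simp: shift_map_def\<close>)
qed

text \<open>A violation of either clause is visible on at most four coordinates.\<close>

lemma closed_Z: "closedin (full_shift_topology {..<p * q}) Z"
proof (rule closedin_full_shift)
  fix y assume "y \<in> S" "y \<notin> Z"
  then obtain i j where ij: "\<not> diff (y i) (y (i + 1)) < p + q - 1 \<or>
      i < j \<and> q \<le> diff (y i) (y (i + 1)) \<and> diff (y j) (y (j + 1)) \<notin> P"
    unfolding Z_def by blast
  have "z \<notin> Z" if "\<forall>k\<in>{i, i + 1, j, j + 1}. z k = y k" for z
  proof
    assume "z \<in> Z"
    then have "diff (z i) (z (i + 1)) < p + q - 1"
      "i < j \<longrightarrow> q \<le> diff (z i) (z (i + 1)) \<longrightarrow> diff (z j) (z (j + 1)) \<in> P"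
      unfolding Z_def by blast+
    with ij that show False by simp
  qed
  then show "\<exists>I. finite I \<and> (\<forall>z\<in>S. (\<forall>i\<in>I. z i = y i) \<longrightarrow> z \<notin> Z)"
    by (intro exI[of _ "{i, i + 1, j, j + 1}"]) blast
qed (auto simp: Z_def)

lemma sofic_Z: "sofic {..<p * q} Z"
proof -
  have "(\<lambda>_. 0) \<in> Z"
    using p_gt_1 q_gt_1 by (auto simp: Z_def full_shift_def diff_self)
  then show ?thesis
    unfolding sofic_def subshift_def using closed_Z shift_Z regular_Z by blast
qed

end

theorem theorem4p3:
  fixes p q :: nat
  assumes "coprime p q" and "p > q" and "q > 1"
  shows "\<exists>(A :: nat set) (Z :: (int \<Rightarrow> nat) set).
           sofic A Z \<and> (\<forall>n. complexity Z n = complexity (trace_subshift p q) n)"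
proof -
  interpret coprime_pair p q using assms by unfold_locales auto
  show ?thesis using sofic_Z complexity_Z_eq_trace by blast
qed

end
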